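(* For any SLH formula $\forall h . \phi$, if there is a counterexample interpretation $\Gamma$ with $\Gamma \models \neg \phi$, then there is an interpretation $\Gamma'$ with $\Gamma' \models \neg \phi$ in which every heap-sorted variable is interpreted by a homeomorphism kernel.
   Context: SLH is the theory of singly-linked lists with length over a background arithmetic theory $\mathcal{T_B}$. Its formulae are boolean combinations of $\mathcal{T_B}$-literals and heap functions $\mathit{alias}(h,x,y)$, $\mathit{isPath}(h,x,y)$, $\mathit{pathLength}(h,x,y)$, $\mathit{isNull}(h,x)$, $\mathit{circular}(h,x)$ and heap transformers $h'=\mathit{new}(h,x)$, $h'=\mathit{assign}(h,x,y)$, $h'=\mathit{lookup}(h,x,y)$, $h'=\mathit{update}(h,x,y)$. Here $h,h'$ are heap variables, $x,y$ range over a finite set $P$ of pointer variables (including $\mathbf{null}$), and an interpretation $\Gamma$ maps free variables to elements of the appropriate sort. A heap is a pair $H=\langle L,G\rangle$ with $G$ a finite graph whose edges carry weights in $\mathbb{N}$ (default weight 1) and $L:P\to V(G)$ a labelling. $H$ is a singly linked heap if every vertex has outdegree 1 except a single sink of outdegree 0 labelled by $\mathbf{null}$. $\mathit{pathLength}(H,x,y)$ is the minimal total weight of a path from $L(x)$ to $L(y)$ (or $\infty$ if there is none), and $\mathit{circular}(H,x)$ holds iff there is a non-empty path from $L(x)$ back to $L(x)$. An edge subdivision replaces an edge $(u,v)$ by $(u,q),(q,v)$ with a fresh vertex $q$ and weights summing to $w(u,v)$. Smoothing is the inverse operation, removing an unlabelled vertex with a single incoming edge. Two heaps are homeomorphic ($H\sim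 H'$) iff some subdivision of $H$ is isomorphic, via a graph isomorphism on the parts reachable from $P$ that respects the labelling, to some subdivision of $H'$. The kernel $\mathrm{Ke}(H)$ is the maximally smoothed heap in the homeomorphism class of $H$. It is proved that homeomorphism is sound: homeomorphic heaps agree on all $\mathit{pathLength}$ and $\mathit{circular}$ observations, and each transformer maps homeomorphic heaps to homeomorphic heaps. It is also proved that kernels are small: $\|\mathrm{Ke}(H)\|\le 2\times\|P\|$ vertices.
   Formalization: The equality in h' = new/assign/lookup/update(...) is read as equality up to homeomorphism (with literal equality the claim fails, e.g. h' = assign(h,x,null) can leave a smoothable vertex), and edge weights are taken to be positive naturals. *)

theory Defs
  imports "HOL-Library.Extended_Nat"
begin

text \<open>
  The finite set \<open>P\<close> of pointer variables is an arbitrary finite type with a distinguished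
  element for null.
\<close>

class pointer = finite +
  fixes null_ptr :: 'a

section \<open>Heaps\<close>

text \<open>
  Only finite heaps matter, so vertices are drawn from an infinite supply of names, the natural
  numbers. The values of \<open>weight\<close> off the edge set are meaningless.
\<close>

record 'p heap =
  verts :: "nat set"
  edges :: "(nat \<times> nat) set"
  weight :: "nat \<times> nat \<Rightarrow> nat"
  label :: "'p \<Rightarrow> nat"

text \<open>
  Weights are positive: an edge of weight \<open>n\<close> stands for \<open>n\<close> consecutive list cells. With
  weight 0, subdividing would not be compatible with \<open>lookup\<close>.
\<close>

definition heap :: "'p heap \<Rightarrow> bool" where
  "heap H \<longleftrightarrow> finite (verts H) \<and> edges H \<subseteq> verts H \<times> verts H \<and>
     (\<forall>e\<in>edges H. 0 < weight H e) \<and> range (label H) \<subseteq> verts H"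

definition singly_linked :: "'p::pointer heap \<Rightarrow> bool" where
  "singly_linked H \<longleftrightarrow> heap H \<and>
     (\<forall>v\<in>verts H. card {t. (v, t) \<in> edges H} = (if v = label H null_ptr then 0 else 1))"

inductive path :: "'p heap \<Rightarrow> nat \<Rightarrow> nat \<Rightarrow> nat \<Rightarrow> bool" for H where
  "v \<in> verts H \<Longrightarrow> path H v 0 v"
| "(u, v) \<in> edges H \<Longrightarrow> path H v n t \<Longrightarrow> path H u (weight H (u, v) + n) t"

text \<open>The infimum of the empty set is \<open>\<infinity>\<close>.\<close>

definition path_length :: "'p heap \<Rightarrow> 'p \<Rightarrow> 'p \<Rightarrow> enat" where
  "path_length H x y = Inf {enat n | n. path H (label H x) n (label H y)}"

definition is_path :: "'p heap \<Rightarrow> 'p \<Rightarrow> 'p \<Rightarrow> bool" where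
  "is_path H x y \<longleftrightarrow> (label H x, label H y) \<in> (edges H)\<^sup>*"

definition is_alias :: "'p heap \<Rightarrow> 'p \<Rightarrow> 'p \<Rightarrow> bool" where
  "is_alias H x y \<longleftrightarrow> label H x = label H y"

definition is_null :: "'p::pointer heap \<Rightarrow> 'p \<Rightarrow> bool" where
  "is_null H x \<longleftrightarrow> label H x = label H null_ptr"

definition circular :: "'p heap \<Rightarrow> 'p \<Rightarrow> bool" where
  "circular H x \<longleftrightarrow> (label H x, label H x) \<in> (edges H)\<^sup>+"

section \<open>Homeomorphism and kernels\<close>

definition subdivides :: "'p heap \<Rightarrow> 'p heap \<Rightarrow> bool" where
  "subdivides H H' \<longleftrightarrow> (\<exists>u v q. (u, v) \<in> edges H \<and> q \<notin> verts H \<and>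
     verts H' = insert q (verts H) \<and>
     edges H' = (edges H - {(u, v)}) \<union> {(u, q), (q, v)} \<and>
     (\<forall>e \<in> edges H - {(u, v)}. weight H' e = weight H e) \<and>
     0 < weight H' (u, q) \<and> 0 < weight H' (q, v) \<and>
     weight H' (u, q) + weight H' (q, v) = weight H (u, v) \<and>
     label H' = label H)"

text \<open>
  Since \<open>H'\<close> is required to be a heap, the removed vertex is unlabelled and has a single incoming
  and a single outgoing edge.
\<close>

definition smooths :: "'p heap \<Rightarrow> 'p heap \<Rightarrow> bool" where
  "smooths H H' \<longleftrightarrow> heap H' \<and> subdivides H' H"

definition reachable :: "'p heap \<Rightarrow> nat set" where
  "reachable H = {v. \<exists>p. (label H p, v) \<in> (edges H)\<^sup>*}"

definition isomorphic :: "'p heap \<Rightarrow> 'p heap \<Rightarrow> bool" where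
  "isomorphic H H' \<longleftrightarrow> (\<exists>f. bij_betw f (reachable H) (reachable H') \<and>
     (\<forall>u\<in>reachable H. \<forall>v\<in>reachable H.
        ((u, v) \<in> edges H \<longleftrightarrow> (f u, f v) \<in> edges H') \<and>
        ((u, v) \<in> edges H \<longrightarrow> weight H' (f u, f v) = weight H (u, v))) \<and>
     (\<forall>p. f (label H p) = label H' p))"

definition homeomorphic :: "'p heap \<Rightarrow> 'p heap \<Rightarrow> bool" (infix "\<sim>" 50) where
  "H \<sim> H' \<longleftrightarrow>
     (\<exists>S S'. subdivides\<^sup>*\<^sup>* H S \<and> subdivides\<^sup>*\<^sup>* H' S' \<and> isomorphic S S')"

text \<open>
  A homeomorphism class does not constrain the vertices that are unreachable from \<open>P\<close>, so its
  maximally smoothed member has none.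
\<close>

definition is_kernel_of :: "'p::pointer heap \<Rightarrow> 'p heap \<Rightarrow> bool" where
  "is_kernel_of K H \<longleftrightarrow> singly_linked K \<and> K \<sim> H \<and>
     verts K = reachable K \<and> (\<nexists>K'. smooths K K')"

definition homeomorphism_kernel :: "'p::pointer heap \<Rightarrow> bool" where
  "homeomorphism_kernel K \<longleftrightarrow> (\<exists>H. singly_linked H \<and> is_kernel_of K H)"

section \<open>Heap transformers\<close>

text \<open>
  Transformers are relations between the old and the new heap: fresh vertices are chosen
  arbitrarily, and \<open>lookup\<close> and \<open>update\<close> are undefined when they dereference null.
  A fresh cell points to null.
\<close>

definition new_heap :: "'p::pointer \<Rightarrow> 'p heap \<Rightarrow> 'p heap \<Rightarrow> bool" where
  "new_heap x H H' \<longleftrightarrow> (\<exists>q. q \<notin> verts H \<and>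
     H' = H\<lparr>verts := insert q (verts H),
            edges := insert (q, label H null_ptr) (edges H),
            weight := (weight H)((q, label H null_ptr) := 1),
            label := (label H)(x := q)\<rparr>)"

definition assign_heap :: "'p \<Rightarrow> 'p \<Rightarrow> 'p heap \<Rightarrow> 'p heap \<Rightarrow> bool" where
  "assign_heap x y H H' \<longleftrightarrow> H' = H\<lparr>label := (label H)(x := label H y)\<rparr>"

text \<open>
  The next cell after \<open>y\<close> is at distance 1, so an outgoing edge of larger weight has to be
  subdivided first.
\<close>

definition lookup_heap :: "'p \<Rightarrow> 'p \<Rightarrow> 'p heap \<Rightarrow> 'p heap \<Rightarrow> bool" where
  "lookup_heap x y H H' \<longleftrightarrow> (\<exists>S v. (S = H \<or> subdivides H S) \<and>
     (label S y, v) \<in> edges S \<and> weight S (label S y, v) = 1 \<and>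
     H' = S\<lparr>label := (label S)(x := v)\<rparr>)"

definition update_heap :: "'p \<Rightarrow> 'p \<Rightarrow> 'p heap \<Rightarrow> 'p heap \<Rightarrow> bool" where
  "update_heap x y H H' \<longleftrightarrow> (\<exists>v. (label H x, v) \<in> edges H \<and>
     H' = H\<lparr>edges := insert (label H x, label H y) (edges H - {(label H x, v)}),
            weight := (weight H)((label H x, label H y) := 1)\<rparr>)"

section \<open>Formulae\<close>

text \<open>
  Type variables: \<open>'h\<close> heap variables, \<open>'p\<close> pointer variables, \<open>'a\<close> variables of the background
  theory, \<open>'f\<close> and \<open>'r\<close> its function and relation symbols, \<open>'d\<close> its domain. The function
  \<open>of_length\<close> says how the background theory represents the lengths and \<open>\<infinity>\<close>.
\<close>

record ('f, 'r, 'd) background =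
  fun_of :: "'f \<Rightarrow> 'd list \<Rightarrow> 'd"
  rel_of :: "'r \<Rightarrow> 'd list \<Rightarrow> bool"
  of_length :: "enat \<Rightarrow> 'd"

datatype ('h, 'p, 'a, 'f) slh_term =
    Var 'a
  | App 'f "('h, 'p, 'a, 'f) slh_term list"
  | PathLength 'h 'p 'p

text \<open>In the last four atoms the first heap variable is \<open>h'\<close>, e.g. \<open>h' = new(h, x)\<close>.\<close>

datatype ('h, 'p, 'a, 'f, 'r) slh_form =
    Lit 'r "('h, 'p, 'a, 'f) slh_term list"
  | Alias 'h 'p 'p
  | IsPath 'h 'p 'p
  | IsNull 'h 'p
  | Circular 'h 'p
  | New 'h 'h 'p
  | Assign 'h 'h 'p 'p
  | Lookup 'h 'h 'p 'p
  | Update 'h 'h 'p 'p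
  | Neg "('h, 'p, 'a, 'f, 'r) slh_form"
  | Conj "('h, 'p, 'a, 'f, 'r) slh_form" "('h, 'p, 'a, 'f, 'r) slh_form"
  | Disj "('h, 'p, 'a, 'f, 'r) slh_form" "('h, 'p, 'a, 'f, 'r) slh_form"

record ('h, 'p, 'a, 'd) interp =
  heap_of :: "'h \<Rightarrow> 'p heap"
  val_of :: "'a \<Rightarrow> 'd"

definition interpretation_slh :: "('h, 'p::pointer, 'a, 'd) interp \<Rightarrow> bool" where
  "interpretation_slh \<Gamma> \<longleftrightarrow> (\<forall>h. singly_linked (heap_of \<Gamma> h))"

primrec term_val ::
  "('f, 'r, 'd) background \<Rightarrow> ('h, 'p, 'a, 'd) interp \<Rightarrow> ('h, 'p, 'a, 'f) slh_term \<Rightarrow> 'd"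
where
  "term_val T \<Gamma> (Var a) = val_of \<Gamma> a"
| "term_val T \<Gamma> (App f ts) = fun_of T f (map (term_val T \<Gamma>) ts)"
| "term_val T \<Gamma> (PathLength h x y) = of_length T (path_length (heap_of \<Gamma> h) x y)"

text \<open>
  The equality in \<open>h' = new(h, x)\<close> etc. is equality up to homeomorphism. It cannot be equality
  of graphs: for instance, \<open>assign\<close> may remove the last label of a vertex, after which no kernel
  is equal (or isomorphic) to the resulting heap.
\<close>

primrec sat ::
  "('f, 'r, 'd) background \<Rightarrow> ('h, 'p::pointer, 'a, 'd) interp \<Rightarrow>
   ('h, 'p, 'a, 'f, 'r) slh_form \<Rightarrow> bool"
where
  "sat T \<Gamma> (Lit r ts) \<longleftrightarrow> rel_of T r (map (term_val T \<Gamma>) ts)"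
| "sat T \<Gamma> (Alias h x y) \<longleftrightarrow> is_alias (heap_of \<Gamma> h) x y"
| "sat T \<Gamma> (IsPath h x y) \<longleftrightarrow> is_path (heap_of \<Gamma> h) x y"
| "sat T \<Gamma> (IsNull h x) \<longleftrightarrow> is_null (heap_of \<Gamma> h) x"
| "sat T \<Gamma> (Circular h x) \<longleftrightarrow> circular (heap_of \<Gamma> h) x"
| "sat T \<Gamma> (New h' h x) \<longleftrightarrow> (\<exists>H. new_heap x (heap_of \<Gamma> h) H \<and> heap_of \<Gamma> h' \<sim> H)"
| "sat T \<Gamma> (Assign h' h x y) \<longleftrightarrow> (\<exists>H. assign_heap x y (heap_of \<Gamma> h) H \<and> heap_of \<Gamma> h' \<sim> H)"
| "sat T \<Gamma> (Lookup h' h x y) \<longleftrightarrow> (\<exists>H. lookup_heap x y (heap_of \<Gamma> h) H \<and> heap_of \<Gamma> h' \<sim> H)"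
| "sat T \<Gamma> (Update h' h x y) \<longleftrightarrow> (\<exists>H. update_heap x y (heap_of \<Gamma> h) H \<and> heap_of \<Gamma> h' \<sim> H)"
| "sat T \<Gamma> (Neg \<phi>) \<longleftrightarrow> \<not> sat T \<Gamma> \<phi>"
| "sat T \<Gamma> (Conj \<phi> \<psi>) \<longleftrightarrow> sat T \<Gamma> \<phi> \<and> sat T \<Gamma> \<psi>"
| "sat T \<Gamma> (Disj \<phi> \<psi>) \<longleftrightarrow> sat T \<Gamma> \<phi> \<or> sat T \<Gamma> \<psi>"

end

theory Submission
  imports Defs
begin

text \<open>
  An edge of weight \<open>n\<close> stands for \<open>n\<close> consecutive list cells, and a pointer variable \<open>p\<close> together
  with a distance \<open>n\<close> names the cell reached from \<open>p\<close> after \<open>n\<close> steps. For heaps of outdegree at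
  most 1, the relation "\<open>(p, n)\<close> and \<open>(q, m)\<close> name the same cell" is a complete invariant of
  homeomorphism: subdivisions and isomorphisms preserve it, and conversely it determines the
  reachable part of a subdivision into edges of weight 1. All observations can be read off this
  relation, and the relation of a transformed heap depends only on that of the original heap.
  Hence replacing every heap by a homeomorphic one preserves the truth of every formula. A kernel
  is a heap with the fewest vertices among the singly linked heaps with the given relation.
\<close>

text \<open>Being singly linked is not invariant under the transformers:
  \<open>assign_heap null_ptr y\<close>, for instance, may move the null label to a vertex that has
  a successor. Outdegree at most 1 survives every transformer and every subdivision.\<close>

definition functional_heap :: "'p heap \<Rightarrow> bool" where
  "functional_heap H \<longleftrightarrow> heap H \<and> single_valued (edges H)"

text \<open>
  The pair \<open>(u, k)\<close> is the list cell at distance \<open>k\<close> from the vertex \<open>u\<close> on the edge that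
  leaves \<open>u\<close>.
\<close>

definition step :: "'p heap \<Rightarrow> nat \<times> nat \<Rightarrow> nat \<times> nat \<Rightarrow> bool" where
  "step H c d \<longleftrightarrow> (\<exists>v. (fst c, v) \<in> edges H \<and> snd c < weight H (fst c, v) \<and>
     d = (if Suc (snd c) = weight H (fst c, v) then (v, 0) else (fst c, Suc (snd c))))"

definition cell_at :: "'p heap \<Rightarrow> 'p \<Rightarrow> nat \<Rightarrow> nat \<times> nat \<Rightarrow> bool" where
  "cell_at H p n c \<longleftrightarrow> (step H ^^ n) (label H p, 0) c"

definition reachable_cells :: "'p heap \<Rightarrow> (nat \<times> nat) set" where
  "reachable_cells H = {c. \<exists>p n. cell_at H p n c}"

definition same_cell :: "'p heap \<Rightarrow> 'p \<Rightarrow> nat \<Rightarrow> 'p \<Rightarrow> nat \<Rightarrow> bool" where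
  "same_cell H p n q m \<longleftrightarrow> (\<exists>c. cell_at H p n c \<and> cell_at H q m c)"

section \<open>Cells\<close>

declare split_paired_Ex [simp del] split_paired_All [simp del]

lemma step_Pair:
  "step H (u, k) d \<longleftrightarrow> (\<exists>v. (u, v) \<in> edges H \<and> k < weight H (u, v) \<and>
     d = (if Suc k = weight H (u, v) then (v, 0) else (u, Suc k)))"
  by (simp add: step_def)

lemma functional_heapD:
  assumes "functional_heap H"
  shows "heap H" "finite (verts H)" "edges H \<subseteq> verts H \<times> verts H"
    "\<And>e. e \<in> edges H \<Longrightarrow> 0 < weight H e" "\<And>p. label H p \<in> verts H"
    "\<And>u v w. (u, v) \<in> edges H \<Longrightarrow> (u, w) \<in> edges H \<Longrightarrow> v = w"
    "\<And>u v. (u, v) \<in> edges H \<Longrightarrow> u \<in> verts H" "\<And>u v. (u, v) \<in> edges H \<Longrightarrow> v \<in> verts H"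
  using assms by (auto simp: functional_heap_def heap_def single_valued_def)

lemma singly_linked_functional:
  assumes "singly_linked H"
  shows "functional_heap H"
proof -
  have h: "heap H"
    and c: "\<And>v. v \<in> verts H \<Longrightarrow>
      card {t. (v, t) \<in> edges H} = (if v = label H null_ptr then 0 else 1)"
    using assms by (auto simp: singly_linked_def)
  have "v = w" if "(u, v) \<in> edges H" "(u, w) \<in> edges H" for u v w
  proof -
    have u: "u \<in> verts H" and "{t. (u, t) \<in> edges H} \<subseteq> verts H" and "finite (verts H)"
      using h that by (auto simp: heap_def)
    \<comment> \<open>Infinite sets also have \<open>card\<close> 0, so the bound on
      \<open>card\<close> gives uniqueness only for a set known to be finite.\<close>
    then have f: "finite {t. (u, t) \<in> edges H}" by (auto intro: finite_subset)
    have "card {t. (u, t) \<in> edges H} \<le> 1" using c[OF u] by simp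
    then show ?thesis using f that by (auto simp: card_le_Suc0_iff_eq)
  qed
  then show ?thesis using h by (auto simp: functional_heap_def single_valued_def)
qed

lemma step_deterministic:
  assumes "functional_heap H" "step H c d" "step H c d'"
  shows "d = d'"
  using assms functional_heapD(6)[OF assms(1)] unfolding step_def by metis

lemma cell_at_0 [simp]: "cell_at H p 0 c \<longleftrightarrow> c = (label H p, 0)"
  by (auto simp: cell_at_def)

lemma cell_at_Suc: "cell_at H p (Suc n) d \<longleftrightarrow> (\<exists>c. cell_at H p n c \<and> step H c d)"
  by (auto simp: cell_at_def)

lemma cell_at_unique:
  assumes "functional_heap H" "cell_at H p n c" "cell_at H p n d"
  shows "c = d"
  using assms(2,3)
proof (induction n arbitrary: c d)
  case (Suc n)
  then show ?case using step_deterministic[OF assms(1)] by (metis cell_at_Suc)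
qed simp

lemma reachable_cells_label: "(label H p, 0) \<in> reachable_cells H"
  unfolding reachable_cells_def mem_Collect_eq by (metis cell_at_0)

lemma reachable_cells_step:
  "c \<in> reachable_cells H \<Longrightarrow> step H c d \<Longrightarrow> d \<in> reachable_cells H"
  unfolding reachable_cells_def mem_Collect_eq using cell_at_Suc by metis

lemma cell_at_in_verts:
  assumes "heap H" "cell_at H p n c"
  shows "fst c \<in> verts H"
  using assms(2)
proof (induction n arbitrary: c)
  case 0
  then show ?case using assms(1) by (auto simp: heap_def)
next
  case (Suc n)
  then show ?case using assms(1) by (auto simp: heap_def cell_at_Suc step_def)
qed

lemma reachable_cells_in_verts:
  "heap H \<Longrightarrow> c \<in> reachable_cells H \<Longrightarrow> fst c \<in> verts H"
  by (auto simp: reachable_cells_def dest: cell_at_in_verts)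

section \<open>Transfer of the naming relation along maps of cells\<close>

text \<open>The map \<open>g\<close> is a bisimulation on a set \<open>C\<close> that contains the
  label cells and is closed under \<open>step\<close>, so a name denotes \<open>c\<close> in
  \<open>H\<close> only if it denotes \<open>g c\<close> in \<open>H'\<close>, and every denoted
  cell of \<open>H'\<close> arises so. Injectivity pulls coincidences back. Since \<open>C\<close>
  may exceed the reachable cells, it can be chosen by a simple condition on vertex and
  offset.\<close>

lemma same_cell_transfer:
  assumes lab: "\<And>p. g (label H p, 0) = (label H' p, 0)"
    and C0: "\<And>p. (label H p, 0) \<in> C"
    and fwd: "\<And>c d. c \<in> C \<Longrightarrow> step H c d \<Longrightarrow> d \<in> C \<and> step H' (g c) (g d)"
    and bwd: "\<And>c d'. c \<in> C \<Longrightarrow> step H' (g c) d' \<Longrightarrow> \<exists>d. step H c d \<and> d' = g d"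
    and inj: "inj_on g C"
  shows "same_cell H = same_cell H'"
proof -
  have 1: "c \<in> C \<and> cell_at H' p n (g c)" if "cell_at H p n c" for p n c
    using that
  proof (induction n arbitrary: c)
    case 0
    then show ?case using lab C0 by simp
  next
    case (Suc n)
    then show ?case using fwd by (metis cell_at_Suc)
  qed
  have 2: "\<exists>c. cell_at H p n c \<and> c' = g c" if "cell_at H' p n c'" for p n c'
    using that
  proof (induction n arbitrary: c')
    case 0
    then show ?case using lab by simp
  next
    case (Suc n)
    then obtain b' where b': "cell_at H' p n b'" "step H' b' c'" by (auto simp: cell_at_Suc)
    then obtain b where b: "cell_at H p n b" "b' = g b" using Suc.IH by blast
    then obtain c where "step H b c" "c' = g c" using b' bwd 1 by blast
    then show ?case using b by (auto simp: cell_at_Suc)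
  qed
  have "same_cell H p n q m \<longleftrightarrow> same_cell H' p n q m" for p n q m
  proof
    assume "same_cell H p n q m"
    then show "same_cell H' p n q m" using 1 unfolding same_cell_def by blast
  next
    assume "same_cell H' p n q m"
    then obtain c' where c': "cell_at H' p n c'" "cell_at H' q m c'"
      by (auto simp: same_cell_def)
    then obtain c d where "cell_at H p n c" "c' = g c" "cell_at H q m d" "c' = g d"
      using 2 by meson
    moreover from this have "c = d" using inj 1 by (metis inj_onD)
    ultimately show "same_cell H p n q m" by (auto simp: same_cell_def)
  qed
  then show ?thesis by (intro ext)
qed

text \<open>A cell of \<open>H\<close> goes to the cell of \<open>H'\<close> that has the same name.
  Equality of the two relations makes this independent of the name chosen, and injective;
  determinism of \<open>step\<close> makes the cell with a given name unique.\<close>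

lemma same_cell_matching:
  assumes H: "functional_heap H" and H': "functional_heap H'"
    and eq: "same_cell H = same_cell H'"
  obtains g where "bij_betw g (reachable_cells H) (reachable_cells H')"
    "\<And>p. g (label H p, 0) = (label H' p, 0)"
    "\<And>c d. c \<in> reachable_cells H \<Longrightarrow> d \<in> reachable_cells H \<Longrightarrow>
       step H c d \<longleftrightarrow> step H' (g c) (g d)"
proof -
  define g where "g c = (SOME c'. \<exists>p n. cell_at H p n c \<and> cell_at H' p n c')" for c
  \<comment> \<open>The diagonal instance \<open>same_cell H p n p n\<close> says that
    \<open>n\<close> steps from \<open>p\<close> are possible, so the relation also records which
    names denote a cell.\<close>
  have ex': "\<exists>c'. cell_at H' p n c'" if "cell_at H p n c" for p n c
    using that eq unfolding same_cell_def by metis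
  have ex: "\<exists>c. cell_at H p n c" if "cell_at H' p n c'" for p n c'
    using that eq unfolding same_cell_def by metis
  have g: "cell_at H' p n (g c)" if c: "cell_at H p n c" for p n c
  proof -
    have "\<exists>c' p n. cell_at H p n c \<and> cell_at H' p n c'" using ex'[OF c] c by blast
    then have "\<exists>p n. cell_at H p n c \<and> cell_at H' p n (g c)"
      unfolding g_def by (rule someI_ex)
    then obtain q m where q: "cell_at H q m c" "cell_at H' q m (g c)" by blast
    then have "same_cell H p n q m" using c by (auto simp: same_cell_def)
    then have "same_cell H' p n q m" using eq by simp
    then obtain d where "cell_at H' p n d" "cell_at H' q m d" by (auto simp: same_cell_def)
    then show ?thesis using cell_at_unique[OF H'] q by metis
  qed
  have inj: "inj_on g (reachable_cells H)"
  proof (rule inj_onI)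
    fix c d assume "c \<in> reachable_cells H" "d \<in> reachable_cells H" and cd: "g c = g d"
    then obtain p n q m where pq: "cell_at H p n c" "cell_at H q m d"
      by (auto simp: reachable_cells_def)
    then have "same_cell H' p n q m" using g cd by (metis same_cell_def)
    then have "same_cell H p n q m" using eq by simp
    then show "c = d" using pq cell_at_unique[OF H] by (metis same_cell_def)
  qed
  have img: "g ` reachable_cells H = reachable_cells H'"
  proof
    show "g ` reachable_cells H \<subseteq> reachable_cells H'"
      using g unfolding reachable_cells_def by blast
    show "reachable_cells H' \<subseteq> g ` reachable_cells H"
    proof
      fix c' assume "c' \<in> reachable_cells H'"
      then obtain p n where c': "cell_at H' p n c'" by (auto simp: reachable_cells_def)
      then obtain c where c: "cell_at H p n c" using ex by blast
      then have "c' = g c" using g c' cell_at_unique[OF H'] by blast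
      then show "c' \<in> g ` reachable_cells H" using c by (auto simp: reachable_cells_def)
    qed
  qed
  have lab: "g (label H p, 0) = (label H' p, 0)" for p
    using g[of p 0 "(label H p, 0)"] by simp
  have st: "step H c d \<longleftrightarrow> step H' (g c) (g d)"
    if cC: "c \<in> reachable_cells H" and dC: "d \<in> reachable_cells H" for c d
  proof -
    obtain p n where c: "cell_at H p n c" using cC by (auto simp: reachable_cells_def)
    show ?thesis
    proof
      assume "step H c d"
      then have "cell_at H p (Suc n) d" using c by (auto simp: cell_at_Suc)
      then have "cell_at H' p (Suc n) (g d)" by (rule g)
      then show "step H' (g c) (g d)" using g[OF c] cell_at_unique[OF H'] by (metis cell_at_Suc)
    next
      assume "step H' (g c) (g d)"
      then have d': "cell_at H' p (Suc n) (g d)" using g[OF c] by (auto simp: cell_at_Suc)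
      then obtain e where e: "cell_at H p (Suc n) e" using ex by blast
      then have "g e = g d" using g d' cell_at_unique[OF H'] by blast
      moreover have "e \<in> reachable_cells H" using e by (auto simp: reachable_cells_def)
      ultimately have "e = d" using inj dC by (auto dest: inj_onD)
      then show "step H c d" using e c cell_at_unique[OF H] by (metis cell_at_Suc)
    qed
  qed
  show ?thesis using that[of g] inj img lab st by (auto simp: bij_betw_def)
qed

section \<open>Homeomorphism in terms of cells\<close>

lemma subdividesE:
  assumes "subdivides H S"
  obtains u v q where "(u, v) \<in> edges H" "q \<notin> verts H" "verts S = insert q (verts H)"
    "edges S = (edges H - {(u, v)}) \<union> {(u, q), (q, v)}"
    "\<forall>e \<in> edges H - {(u, v)}. weight S e = weight H e"
    "0 < weight S (u, q)" "0 < weight S (q, v)"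
    "weight S (u, q) + weight S (q, v) = weight H (u, v)" "label S = label H"
  using assms unfolding subdivides_def by (elim exE conjE) (rule that)

lemma subdivides_functional:
  assumes H: "functional_heap H" and s: "subdivides H S"
  shows "functional_heap S"
proof -
  obtain u v q where uv: "(u, v) \<in> edges H" and q: "q \<notin> verts H"
    and V: "verts S = insert q (verts H)"
    and E: "edges S = (edges H - {(u, v)}) \<union> {(u, q), (q, v)}"
    and W: "\<forall>e \<in> edges H - {(u, v)}. weight S e = weight H e"
    and w0: "0 < weight S (u, q)" "0 < weight S (q, v)"
    and w: "weight S (u, q) + weight S (q, v) = weight H (u, v)"
    and L: "label S = label H"
    using s by (rule subdividesE)
  have "heap S"
    using functional_heapD(2-5)[OF H] functional_heapD(7,8)[OF H uv] V E W w0 L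
    by (auto simp: heap_def)
  moreover have "single_valued (edges S)"
  proof (rule single_valuedI)
    fix a b c assume "(a, b) \<in> edges S" "(a, c) \<in> edges S"
    then show "b = c"
      using functional_heapD(6)[OF H, of a] functional_heapD(7)[OF H, of a] uv q
      unfolding E by auto
  qed
  ultimately show ?thesis by (simp add: functional_heap_def)
qed

text \<open>The new vertex \<open>q\<close> lies \<open>w1\<close> cells down the old edge, so the
  cell \<open>(q, k)\<close> of \<open>S\<close> is the cell \<open>(u, w1 + k)\<close> of
  \<open>H\<close>; all other cells keep their coordinates.\<close>

lemma subdivides_same_cell:
  assumes H: "functional_heap H" and s: "subdivides H S"
  shows "same_cell S = same_cell H"
proof -
  obtain u v q where uv: "(u, v) \<in> edges H" and q: "q \<notin> verts H"
    and V: "verts S = insert q (verts H)"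
    and E: "edges S = (edges H - {(u, v)}) \<union> {(u, q), (q, v)}"
    and W: "\<forall>e \<in> edges H - {(u, v)}. weight S e = weight H e"
    and w0: "0 < weight S (u, q)" "0 < weight S (q, v)"
    and w: "weight S (u, q) + weight S (q, v) = weight H (u, v)"
    and L: "label S = label H"
    using s by (rule subdividesE)
  have S: "functional_heap S" using subdivides_functional[OF H s] .
  define w1 where "w1 = weight S (u, q)"
  define w2 where "w2 = weight S (q, v)"
  have w12: "weight H (u, v) = w1 + w2" "0 < w1" "0 < w2"
    using w w0 by (auto simp: w1_def w2_def)
  have uH: "u \<in> verts H" "v \<in> verts H" "u \<noteq> q" "v \<noteq> q"
    using functional_heapD(7,8)[OF H uv] q by auto
  have fu: "t = v" if "(u, t) \<in> edges H" for t using functional_heapD(6)[OF H uv that] by simp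
  have tq: "t \<noteq> q" "a \<noteq> q" if "(a, t) \<in> edges H" for a t
    using functional_heapD(7,8)[OF H that] q by auto
  have Su: "(u, t) \<in> edges S \<longleftrightarrow> t = q" for t using E fu uH by auto
  have Sq: "(q, t) \<in> edges S \<longleftrightarrow> t = v" for t using E tq(2)[of q t] uH by auto
  have Sa: "(a, t) \<in> edges S \<longleftrightarrow> (a, t) \<in> edges H" if "a \<noteq> u" "a \<noteq> q" for a t
    using E that by auto
  have Hu: "(u, t) \<in> edges H \<longleftrightarrow> t = v" for t using uv fu by blast
  have Wa: "weight S (a, t) = weight H (a, t)" if "a \<noteq> u" "a \<noteq> q" "(a, t) \<in> edges H" for a t
    using W that by auto
  have stSu: "step S (u, k) d \<longleftrightarrow> k < w1 \<and> d = (if Suc k = w1 then (q, 0) else (u, Suc k))"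
    for k d by (auto simp: step_Pair Su w1_def)
  have stSq: "step S (q, k) d \<longleftrightarrow> k < w2 \<and> d = (if Suc k = w2 then (v, 0) else (q, Suc k))"
    for k d by (auto simp: step_Pair Sq w2_def)
  have stHu: "step H (u, k) d \<longleftrightarrow>
      k < w1 + w2 \<and> d = (if Suc k = w1 + w2 then (v, 0) else (u, Suc k))"
    for k d by (auto simp: step_Pair Hu w12(1))
  have stSa: "step S (a, k) d \<longleftrightarrow> step H (a, k) d" if "a \<noteq> u" "a \<noteq> q" for a k d
    using that Wa by (auto simp: step_Pair Sa)
  have nq: "fst d \<noteq> q" if "step H (a, k) d" for a k d
    using that unfolding step_Pair by (metis fst_conv tq)
  define g where "g c = (if fst c = q then (u, w1 + snd c) else c)" for c :: "nat \<times> nat"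
  \<comment> \<open>The pairs \<open>(u, k)\<close> with \<open>k \<ge> w1\<close> are no longer
    cells of \<open>S\<close>. Under \<open>g\<close> they would collide with images of pairs on
    \<open>q\<close>.\<close>
  define C where "C = {c :: nat \<times> nat. fst c = u \<longrightarrow> snd c < w1}"
  show ?thesis
  proof (rule same_cell_transfer[where g = g and C = C])
    show "g (label S p, 0) = (label H p, 0)" for p
      using L q functional_heapD(5)[OF H, of p] by (auto simp: g_def)
    show "(label S p, 0) \<in> C" for p using w12 by (auto simp: C_def)
    show "inj_on g C" using uH by (auto simp: inj_on_def g_def C_def split: if_splits)
  next
    fix c d assume c: "c \<in> C" and s: "step S c d"
    obtain a k where ak: "c = (a, k)" by (cases c)
    consider "a = u" | "a = q" | "a \<noteq> u" "a \<noteq> q" by blast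
    then show "d \<in> C \<and> step H (g c) (g d)"
    proof cases
      case 1
      then show ?thesis using s ak uH w12 by (auto simp: stSu stHu g_def C_def)
    next
      case 2
      then show ?thesis using s ak uH w12 by (auto simp: stSq stHu g_def C_def)
    next
      case 3
      then have "step H (a, k) d" using s ak stSa by simp
      moreover from this have "fst d \<noteq> q" by (rule nq)
      moreover have "d \<in> C" using \<open>step H (a, k) d\<close> 3 w12
        by (auto simp: step_Pair C_def)
      ultimately show ?thesis using 3 ak by (simp add: g_def)
    qed
  next
    fix c d' assume c: "c \<in> C" and s: "step H (g c) d'"
    obtain a k where ak: "c = (a, k)" by (cases c)
    consider "a = u" | "a = q" | "a \<noteq> u" "a \<noteq> q" by blast
    then show "\<exists>d. step S c d \<and> d' = g d"
    proof cases
      case 1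
      then have "k < w1" using c ak by (simp add: C_def)
      then show ?thesis using s ak 1 uH w12 by (auto simp: stSu stHu g_def)
    next
      case 2
      then show ?thesis using s ak uH w12 by (auto simp: stSq stHu g_def)
    next
      case 3
      then have "step H (a, k) d'" using s ak by (simp add: g_def)
      then show ?thesis using stSa[OF 3] nq ak by (intro exI[of _ d']) (simp add: g_def)
    qed
  qed
qed

lemma subdivides_rtranclp:
  assumes "subdivides\<^sup>*\<^sup>* H S" "functional_heap H"
  shows "functional_heap S \<and> same_cell S = same_cell H"
  using assms
  by (induction rule: rtranclp_induct)
     (auto dest: subdivides_functional subdivides_same_cell)

text \<open>The vertex map acts on cells by keeping offsets, which is sound because weights agree.
  It is controlled on reachable vertices only; these are closed under edges in both heaps, so
  successors in \<open>H'\<close> have preimages.\<close>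

lemma isomorphic_same_cell:
  assumes "isomorphic H H'"
  shows "same_cell H = same_cell H'"
proof -
  obtain f where bij: "bij_betw f (reachable H) (reachable H')"
    and ed: "\<And>u v. u \<in> reachable H \<Longrightarrow> v \<in> reachable H \<Longrightarrow>
      (u, v) \<in> edges H \<longleftrightarrow> (f u, f v) \<in> edges H'"
    and wt: "\<And>u v. u \<in> reachable H \<Longrightarrow> v \<in> reachable H \<Longrightarrow> (u, v) \<in> edges H \<Longrightarrow>
      weight H' (f u, f v) = weight H (u, v)"
    and lab: "\<And>p. f (label H p) = label H' p"
    using assms unfolding isomorphic_def by blast
  have cl: "v \<in> reachable G" if "u \<in> reachable G" "(u, v) \<in> edges G" for u v and G :: "'a heap"
    using that by (auto simp: reachable_def intro: rtrancl_into_rtrancl)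
  show ?thesis
  proof (rule same_cell_transfer[where g = "\<lambda>c. (f (fst c), snd c)" and C = "reachable H \<times> UNIV"])
    show "(f (fst (label H p, 0)), snd (label H p, 0)) = (label H' p, 0)" for p
      using lab by simp
    show "(label H p, 0) \<in> reachable H \<times> UNIV" for p by (auto simp: reachable_def)
    show "inj_on (\<lambda>c. (f (fst c), snd c)) (reachable H \<times> UNIV)"
      using bij by (auto simp: bij_betw_def inj_on_def)
  next
    fix c d :: "nat \<times> nat" assume c: "c \<in> reachable H \<times> UNIV" and s: "step H c d"
    then obtain u k v where "c = (u, k)" "u \<in> reachable H" and v: "(u, v) \<in> edges H"
      "k < weight H (u, v)" "d = (if Suc k = weight H (u, v) then (v, 0) else (u, Suc k))"
      by (auto simp: step_Pair)
    moreover from this have "v \<in> reachable H" by (auto intro: cl)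
    ultimately show "d \<in> reachable H \<times> UNIV \<and> step H' (f (fst c), snd c) (f (fst d), snd d)"
      using ed wt by (auto simp: step_Pair intro!: exI[of _ "f v"])
  next
    fix c d' :: "nat \<times> nat"
    assume c: "c \<in> reachable H \<times> UNIV" and s: "step H' (f (fst c), snd c) d'"
    then obtain u k v' where u: "c = (u, k)" "u \<in> reachable H" and v': "(f u, v') \<in> edges H'"
      "k < weight H' (f u, v')"
      "d' = (if Suc k = weight H' (f u, v') then (v', 0) else (f u, Suc k))"
      by (auto simp: step_Pair)
    have "f u \<in> reachable H'" using bij u by (auto simp: bij_betw_def)
    then have "v' \<in> reachable H'" using v' by (auto intro: cl)
    then obtain v where v: "v \<in> reachable H" "v' = f v" using bij by (auto simp: bij_betw_def)
    then have "(u, v) \<in> edges H" using ed u v' by simp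
    then show "\<exists>d. step H c d \<and> d' = (f (fst d), snd d)"
      using u v v' wt by (auto simp: step_Pair)
  qed
qed

section \<open>Subdivision into edges of weight 1\<close>

text \<open>One cell is cut off at the front of the edge. This serves both the repeated splitting
  into unit edges and \<open>lookup_heap\<close>, which needs the first piece to have weight
  1.\<close>

lemma subdivides_edge:
  assumes H: "functional_heap H" and e: "(u, v) \<in> edges H" and w: "1 < weight H (u, v)"
  obtains S q where "subdivides H S" "q \<notin> verts H"
    "edges S = (edges H - {(u, v)}) \<union> {(u, q), (q, v)}"
    "weight S = (weight H)((u, q) := 1, (q, v) := weight H (u, v) - 1)" "label S = label H"
proof -
  obtain q where q: "q \<notin> verts H" using functional_heapD(2)[OF H] ex_new_if_finite by blast
  have u: "u \<noteq> q" "v \<noteq> q" using functional_heapD(7,8)[OF H e] q by auto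
  have n: "(u, q) \<notin> edges H" "(q, v) \<notin> edges H" using functional_heapD(7,8)[OF H] q by blast+
  define S where "S = H\<lparr>verts := insert q (verts H),
    edges := (edges H - {(u, v)}) \<union> {(u, q), (q, v)},
    weight := (weight H)((u, q) := 1, (q, v) := weight H (u, v) - 1)\<rparr>"
  have "subdivides H S"
    unfolding subdivides_def
    by (rule exI[of _ u], rule exI[of _ v], rule exI[of _ q])
       (use e q u n w in \<open>auto simp: S_def\<close>)
  then show ?thesis using that[of S q] q by (simp add: S_def)
qed

text \<open>Induction on the total excess of the weights over 1. Cutting one cell off an edge of
  weight \<open>w > 1\<close> replaces its excess \<open>w - 1\<close> by \<open>0\<close> and
  \<open>w - 2\<close>.\<close>

lemma unit_subdivision:
  assumes "functional_heap H"
  shows "\<exists>S. subdivides\<^sup>*\<^sup>* H S \<and> (\<forall>e\<in>edges S. weight S e = 1)"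
  using assms
proof (induction "\<Sum>e\<in>edges H. weight H e - 1" arbitrary: H rule: less_induct)
  case less
  note H = less.prems
  show ?case
  proof (cases "\<forall>e\<in>edges H. weight H e = 1")
    case False
    then obtain u v where uv: "(u, v) \<in> edges H" and ne: "weight H (u, v) \<noteq> 1" by auto
    then have w: "1 < weight H (u, v)" using functional_heapD(4)[OF H uv] by linarith
    obtain S q where s: "subdivides H S" and q: "q \<notin> verts H"
      and E: "edges S = (edges H - {(u, v)}) \<union> {(u, q), (q, v)}"
      and W: "weight S = (weight H)((u, q) := 1, (q, v) := weight H (u, v) - 1)"
      using subdivides_edge[OF H uv w] by metis
    have fin: "finite (edges H)"
      using functional_heapD(2,3)[OF H] by (meson finite_SigmaI finite_subset)
    have n: "(u, q) \<notin> edges H" "(q, v) \<notin> edges H" "u \<noteq> q"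
      using functional_heapD(7,8)[OF H] q uv by blast+
    let ?R = "edges H - {(u, v)}"
    have "(\<Sum>e\<in>edges S. weight S e - 1) = (\<Sum>e\<in>?R. weight S e - 1) + (weight H (u, v) - 1 - 1)"
      unfolding E using fin n W by (simp add: sum.insert_if insert_commute)
    also have "(\<Sum>e\<in>?R. weight S e - 1) = (\<Sum>e\<in>?R. weight H e - 1)"
      using n W by (intro sum.cong) auto
    \<comment> \<open>Subtraction is truncated; the inequality is strict because the weight exceeds
      1.\<close>
    also have "\<dots> + (weight H (u, v) - 1 - 1) < \<dots> + (weight H (u, v) - 1)" using w by simp
    also have "\<dots> = (\<Sum>e\<in>edges H. weight H e - 1)"
      using fin uv by (simp add: sum.remove)
    finally obtain S' where "subdivides\<^sup>*\<^sup>* S S'" "\<forall>e\<in>edges S'. weight S' e = 1"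
      using less.hyps subdivides_functional[OF H s] by blast
    then show ?thesis using s by (meson converse_rtranclp_into_rtranclp)
  qed blast
qed

lemma unit_step:
  assumes "\<forall>e\<in>edges S. weight S e = 1"
  shows "step S c d \<longleftrightarrow> (fst c, fst d) \<in> edges S \<and> snd c = 0 \<and> snd d = 0"
  using assms by (cases c; cases d) (auto simp: step_Pair)

lemma unit_reachable_cells:
  assumes u: "\<forall>e\<in>edges S. weight S e = 1"
  shows "reachable_cells S = reachable S \<times> {0}"
proof
  have "c \<in> reachable S \<times> {0}" if "cell_at S p n c" for p n c
    using that
  proof (induction n arbitrary: c)
    case 0
    then show ?case by (auto simp: reachable_def)
  next
    case (Suc n)
    then obtain b where "b \<in> reachable S \<times> {0}" "step S b c" by (auto simp: cell_at_Suc)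
    then obtain p x y where "b = (x, 0)" "c = (y, 0)" "(label S p, x) \<in> (edges S)\<^sup>*"
      "(x, y) \<in> edges S"
      by (cases c) (auto simp: unit_step[OF u] reachable_def)
    then show ?case unfolding reachable_def by (blast intro: rtrancl_into_rtrancl)
  qed
  then show "reachable_cells S \<subseteq> reachable S \<times> {0}" unfolding reachable_cells_def by blast
  have "(v, 0) \<in> reachable_cells S" if "(label S p, v) \<in> (edges S)\<^sup>*" for p v
    using that
  proof (induction rule: rtrancl_induct)
    case base
    then show ?case by (rule reachable_cells_label)
  next
    case (step y z)
    then show ?case using reachable_cells_step unit_step[OF u] by (metis fst_conv snd_conv)
  qed
  then show "reachable S \<times> {0} \<subseteq> reachable_cells S" by (auto simp: reachable_def)
qed

text \<open>With unit weights the reachable cells are the reachable vertices at offset 0 and steps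
  between them are edges, so the matching of cells is already a graph isomorphism. Weights agree
  since all are 1.\<close>

lemma unit_isomorphic:
  assumes S: "functional_heap S" and S': "functional_heap S'"
    and u: "\<forall>e\<in>edges S. weight S e = 1" and u': "\<forall>e\<in>edges S'. weight S' e = 1"
    and eq: "same_cell S = same_cell S'"
  shows "isomorphic S S'"
proof -
  obtain g where bij: "bij_betw g (reachable S \<times> {0}) (reachable S' \<times> {0})"
    and lab: "\<And>p. g (label S p, 0) = (label S' p, 0)"
    and st: "\<And>c d. c \<in> reachable S \<times> {0} \<Longrightarrow> d \<in> reachable S \<times> {0} \<Longrightarrow>
       step S c d \<longleftrightarrow> step S' (g c) (g d)"
    using same_cell_matching[OF S S' eq]
    unfolding unit_reachable_cells[OF u] unit_reachable_cells[OF u'] by metis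
  define f where "f v = fst (g (v, 0))" for v
  have gf: "g (v, 0) = (f v, 0)" if "v \<in> reachable S" for v
  proof -
    have "g (v, 0) \<in> reachable S' \<times> {0}" using bij that by (auto simp: bij_betw_def)
    then show ?thesis by (auto simp: f_def)
  qed
  have ed: "(a, b) \<in> edges S \<longleftrightarrow> (f a, f b) \<in> edges S'"
    if "a \<in> reachable S" "b \<in> reachable S" for a b
    using st[of "(a, 0)" "(b, 0)"] that gf by (simp add: unit_step[OF u] unit_step[OF u'])
  have inj: "inj_on f (reachable S)"
  proof (rule inj_onI)
    fix a b assume "a \<in> reachable S" "b \<in> reachable S" "f a = f b"
    then have "g (a, 0) = g (b, 0)" using gf by simp
    then show "a = b" using bij \<open>a \<in> _\<close> \<open>b \<in> _\<close> by (auto simp: bij_betw_def dest: inj_onD)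
  qed
  have "reachable S' \<times> {0 :: nat} = (\<lambda>v. (f v, 0)) ` reachable S"
  proof -
    have "reachable S' \<times> {0 :: nat} = g ` (reachable S \<times> {0})" using bij by (auto simp: bij_betw_def)
    also have "\<dots> = (\<lambda>v. g (v, 0)) ` reachable S" by auto
    also have "\<dots> = (\<lambda>v. (f v, 0)) ` reachable S" using gf by (intro image_cong) auto
    finally show ?thesis .
  qed
  then have "f ` reachable S = reachable S'" by auto
  then have "bij_betw f (reachable S) (reachable S')" using inj by (simp add: bij_betw_def)
  moreover have "f (label S p) = label S' p" for p using lab by (simp add: f_def)
  ultimately show ?thesis unfolding isomorphic_def using ed u u' by metis
qed

text \<open>For the converse, the two unit subdivisions serve as the isomorphic subdivisions. As
  equality of relations is transitive, so is \<open>\<sim>\<close> on these heaps, which its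
  definition does not make evident.\<close>

lemma homeomorphic_iff_same_cell:
  assumes H: "functional_heap H" and H': "functional_heap H'"
  shows "H \<sim> H' \<longleftrightarrow> same_cell H = same_cell H'"
proof
  assume "H \<sim> H'"
  then show "same_cell H = same_cell H'"
    unfolding homeomorphic_def
    using subdivides_rtranclp[OF _ H] subdivides_rtranclp[OF _ H'] isomorphic_same_cell by metis
next
  assume eq: "same_cell H = same_cell H'"
  obtain S where S: "subdivides\<^sup>*\<^sup>* H S" "\<forall>e\<in>edges S. weight S e = 1"
    using unit_subdivision[OF H] by blast
  obtain S' where S': "subdivides\<^sup>*\<^sup>* H' S'" "\<forall>e\<in>edges S'. weight S' e = 1"
    using unit_subdivision[OF H'] by blast
  have "isomorphic S S'"
    using unit_isomorphic[OF _ _ S(2) S'(2)] subdivides_rtranclp[OF S(1) H]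
      subdivides_rtranclp[OF S'(1) H'] eq by simp
  then show "H \<sim> H'" using S S' by (auto simp: homeomorphic_def)
qed

section \<open>Observations\<close>

text \<open>Paths grow at the front by definition, whereas iterated steps are extended at the
  end.\<close>

lemma path_snoc:
  assumes "path H u n v" "(v, t) \<in> edges H" "t \<in> verts H"
  shows "path H u (n + weight H (v, t)) t"
  using assms
proof (induction rule: path.induct)
  case (1 v)
  then show ?case using path.intros(2)[of v t H 0 t] path.intros(1)[of t H] by simp
next
  case (2 u v n t')
  then show ?case using path.intros(2)[of u v H] by (simp add: add.assoc)
qed

lemma steps_along_edge:
  assumes "(u, v) \<in> edges H" "k < weight H (u, v)"
  shows "(step H ^^ k) (u, 0) (u, k)"
  using assms(2)
proof (induction k)
  case (Suc k)
  then have "step H (u, k) (u, Suc k)"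
    unfolding step_Pair using assms(1) by (intro exI[of _ v]) auto
  then show ?case using Suc by auto
qed simp

lemma path_iff_steps:
  assumes H: "heap H" and u: "u \<in> verts H"
  shows "path H u n t \<longleftrightarrow> (step H ^^ n) (u, 0) (t, 0)"
proof
  assume "path H u n t"
  then show "(step H ^^ n) (u, 0) (t, 0)"
  proof (induction rule: path.induct)
    case (2 u v n t)
    \<comment> \<open>No step crosses an edge of weight 0. Positivity splits the weight into
      \<open>k\<close> steps along the edge and a last one onto \<open>v\<close>.\<close>
    have "0 < weight H (u, v)" using H 2 by (auto simp: heap_def)
    then obtain k where k: "weight H (u, v) = Suc k" using gr0_conv_Suc by blast
    then have "(step H ^^ k) (u, 0) (u, k)" using steps_along_edge[OF 2(1)] by simp
    moreover have "step H (u, k) (v, 0)" using k 2 by (auto simp: step_Pair)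
    ultimately have "(step H ^^ weight H (u, v)) (u, 0) (v, 0)" using k by auto
    then show ?case using 2 by (auto simp: relpowp_add)
  qed simp
next
  \<comment> \<open>The induction has to admit walks that stop inside an edge: they consist of a
    path to its source and \<open>snd c\<close> further cells. The claim is the case of offset
    0.\<close>
  have "\<exists>m. path H u m (fst c) \<and> n = m + snd c" if "(step H ^^ n) (u, 0) c" for c
    using that
  proof (induction n arbitrary: c)
    case 0
    then show ?case using u by (auto intro: path.intros)
  next
    case (Suc n)
    then obtain b where "(step H ^^ n) (u, 0) b" and b: "step H b c" by auto
    then obtain m where m: "path H u m (fst b)" "n = m + snd b" using Suc.IH by blast
    obtain v where v: "(fst b, v) \<in> edges H" "snd b < weight H (fst b, v)"
      "c = (if Suc (snd b) = weight H (fst b, v) then (v, 0) else (fst b, Suc (snd b)))"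
      using b by (auto simp: step_def)
    have "v \<in> verts H" using v H by (auto simp: heap_def)
    then have "path H u (m + weight H (fst b, v)) v" using path_snoc m v by blast
    moreover have "m + weight H (fst b, v) = Suc n" if "Suc (snd b) = weight H (fst b, v)"
      using that m by simp
    ultimately show ?case using m v by (cases "Suc (snd b) = weight H (fst b, v)") auto
  qed
  then show "(step H ^^ n) (u, 0) (t, 0) \<Longrightarrow> path H u n t" by fastforce
qed

lemma path_iff_same_cell:
  assumes "heap H"
  shows "path H (label H x) n (label H y) \<longleftrightarrow> same_cell H x n y 0"
proof -
  have "label H x \<in> verts H" using assms by (auto simp: heap_def)
  then show ?thesis using path_iff_steps[OF assms] by (auto simp: same_cell_def cell_at_def)
qed

lemma path_imp_rtrancl:
  assumes "path H u n t"
  shows "(u, t) \<in> (edges H)\<^sup>*" "0 < n \<Longrightarrow> (u, t) \<in> (edges H)\<^sup>+"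
  using assms by (induction rule: path.induct) (auto intro: rtrancl_into_trancl2)

lemma trancl_imp_path:
  assumes "heap H" "(u, t) \<in> (edges H)\<^sup>+"
  shows "\<exists>n>0. path H u n t"
  using assms(2)
proof (induction rule: converse_trancl_induct)
  case (base u)
  then have "t \<in> verts H" "0 < weight H (u, t)" using assms(1) by (auto simp: heap_def)
  then show ?case using path.intros(2)[OF base path.intros(1)] by force
next
  case (step u v)
  then obtain n where "0 < n" "path H v n t" by blast
  then show ?case using path.intros(2)[OF step(1)] by (metis add_gr_0)
qed

lemma path_length_same_cell:
  assumes "heap H"
  shows "path_length H x y = Inf {enat n | n. same_cell H x n y 0}"
  unfolding path_length_def path_iff_same_cell[OF assms] ..

lemma is_alias_same_cell: "is_alias H x y \<longleftrightarrow> same_cell H x 0 y 0"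
  by (auto simp: is_alias_def same_cell_def)

text \<open>As weights are positive, a non-empty path has positive length; a path of positive length
  is conversely non-empty.\<close>

lemma circular_same_cell:
  assumes "heap H"
  shows "circular H x \<longleftrightarrow> (\<exists>n>0. same_cell H x n x 0)"
  unfolding circular_def path_iff_same_cell[OF assms, symmetric]
  using path_imp_rtrancl(2) trancl_imp_path[OF assms] by metis

lemma is_path_same_cell:
  assumes "heap H"
  shows "is_path H x y \<longleftrightarrow> (\<exists>n. same_cell H x n y 0)"
proof -
  have "label H x \<in> verts H" using assms by (auto simp: heap_def)
  then show ?thesis
    unfolding is_path_def path_iff_same_cell[OF assms, symmetric]
    using path_imp_rtrancl(1) trancl_imp_path[OF assms] path.intros(1) by (metis rtranclD)
qed

lemma is_null_same_cell: "is_null H x \<longleftrightarrow> same_cell H x 0 null_ptr 0"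
  by (auto simp: is_null_def same_cell_def)

section \<open>Transformers\<close>

text \<open>The second clause is one-sided, but equality of relations is symmetric. The existential
  accounts for the free choice of fresh vertices, and forces definedness of \<open>R\<close> to
  depend on the relation alone.\<close>

definition cell_invariant :: "('p heap \<Rightarrow> 'p heap \<Rightarrow> bool) \<Rightarrow> bool" where
  "cell_invariant R \<longleftrightarrow>
     (\<forall>H G. functional_heap H \<longrightarrow> R H G \<longrightarrow> functional_heap G) \<and>
     (\<forall>H H' G. functional_heap H \<longrightarrow> functional_heap H' \<longrightarrow> same_cell H = same_cell H' \<longrightarrow>
        R H G \<longrightarrow> (\<exists>G'. R H' G' \<and> same_cell G = same_cell G'))"

text \<open>This evaluates an atom such as \<open>h' = new(h, x)\<close>: on functional heaps
  \<open>\<sim>\<close> is equality of relations, so both the old heap and the claimed result may be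
  exchanged.\<close>

lemma cell_invariant_homeomorphic:
  assumes R: "cell_invariant R"
    and H: "functional_heap H" "functional_heap H'" "same_cell H = same_cell H'"
    and A: "functional_heap A" "functional_heap A'" "same_cell A = same_cell A'"
  shows "(\<exists>G. R H G \<and> A \<sim> G) \<longleftrightarrow> (\<exists>G. R H' G \<and> A' \<sim> G)"
proof -
  have "\<exists>G. R H2 G \<and> A2 \<sim> G"
    if H: "functional_heap H1" "functional_heap H2" "same_cell H1 = same_cell H2"
      and A: "functional_heap A1" "functional_heap A2" "same_cell A1 = same_cell A2"
      and G: "R H1 G" "A1 \<sim> G" for H1 H2 A1 A2 G
  proof -
    obtain G2 where G2: "R H2 G2" "same_cell G = same_cell G2"
      using R H G unfolding cell_invariant_def by blast
    moreover have "functional_heap G" "functional_heap G2"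
      using R H G G2 unfolding cell_invariant_def by blast+
    ultimately show ?thesis using A G homeomorphic_iff_same_cell by metis
  qed
  from this[OF H A] this[OF H(2,1) H(3)[symmetric] A(2,1) A(3)[symmetric]]
  show ?thesis by blast
qed

text \<open>The matching is recast in the form that \<open>same_cell_transfer\<close> consumes.
  Successors of matched cells are reachable again, hence in the range of \<open>g\<close>.\<close>

lemma same_cell_simulation:
  assumes H: "functional_heap H" and H': "functional_heap H'"
    and eq: "same_cell H = same_cell H'"
  obtains g where "\<And>p. g (label H p, 0) = (label H' p, 0)"
    "inj_on g (reachable_cells H)" "g ` reachable_cells H \<subseteq> reachable_cells H'"
    "\<And>c d. c \<in> reachable_cells H \<Longrightarrow> step H c d \<Longrightarrow> step H' (g c) (g d)"
    "\<And>c d'. c \<in> reachable_cells H \<Longrightarrow> step H' (g c) d' \<Longrightarrow> \<exists>d. step H c d \<and> d' = g d"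
proof -
  obtain g where bij: "bij_betw g (reachable_cells H) (reachable_cells H')"
    and lab: "\<And>p. g (label H p, 0) = (label H' p, 0)"
    and st: "\<And>c d. c \<in> reachable_cells H \<Longrightarrow> d \<in> reachable_cells H \<Longrightarrow>
       step H c d \<longleftrightarrow> step H' (g c) (g d)"
    using same_cell_matching[OF H H' eq] by metis
  have "\<exists>d. step H c d \<and> d' = g d"
    if c: "c \<in> reachable_cells H" and s: "step H' (g c) d'" for c d'
  proof -
    have "g c \<in> reachable_cells H'" using bij c by (auto simp: bij_betw_def)
    then have "d' \<in> reachable_cells H'" using s by (rule reachable_cells_step)
    then obtain d where "d \<in> reachable_cells H" "d' = g d"
      using bij unfolding bij_betw_def by blast
    then show ?thesis using st c s by blast
  qed
  moreover have "step H' (g c) (g d)" if "c \<in> reachable_cells H" "step H c d" for c d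
    using that st reachable_cells_step[OF that] by blast
  ultimately show ?thesis using that[of g] bij lab by (auto simp: bij_betw_def)
qed

section \<open>Relabelling: assign and lookup\<close>

lemma cell_at_relabel:
  assumes H: "functional_heap H" and l: "cell_at H r k (l p, 0)"
  shows "cell_at (H\<lparr>label := l\<rparr>) p n c \<longleftrightarrow> cell_at H r (k + n) c"
proof -
  have "step (H\<lparr>label := l\<rparr>) = step H" by (intro ext) (simp add: step_def)
  then have "cell_at (H\<lparr>label := l\<rparr>) p n c \<longleftrightarrow> (step H ^^ n) (l p, 0) c"
    by (simp add: cell_at_def)
  also have "\<dots> \<longleftrightarrow> (\<exists>b. cell_at H r k b \<and> (step H ^^ n) b c)"
    using l cell_at_unique[OF H] by blast
  also have "\<dots> \<longleftrightarrow> cell_at H r (k + n) c"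
    by (auto simp: cell_at_def relpowp_add)
  finally show ?thesis .
qed

text \<open>Each new label is a cell with an old name \<open>(r p, k p)\<close>, the same name in
  both heaps. The new relation is therefore the old one with translated names. Assignment uses
  distance 0 throughout, \<open>lookup_heap\<close> distance 1 for \<open>x\<close>.\<close>

lemma relabel_same_cell:
  assumes H: "functional_heap H" and H': "functional_heap H'"
    and eq: "same_cell H = same_cell H'"
    and l: "\<And>p. cell_at H (r p) (k p) (l p, 0)" and l': "\<And>p. cell_at H' (r p) (k p) (l' p, 0)"
  shows "same_cell (H\<lparr>label := l\<rparr>) = same_cell (H'\<lparr>label := l'\<rparr>)"
proof (intro ext)
  fix p n q m
  have "same_cell (H\<lparr>label := l\<rparr>) p n q m \<longleftrightarrow> same_cell H (r p) (k p + n) (r q) (k q + m)"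
    using cell_at_relabel[of H _ _ l, OF H l] by (simp add: same_cell_def)
  also have "\<dots> \<longleftrightarrow> same_cell (H'\<lparr>label := l'\<rparr>) p n q m"
    unfolding eq using cell_at_relabel[of H' _ _ l', OF H' l'] by (simp add: same_cell_def)
  finally show "same_cell (H\<lparr>label := l\<rparr>) p n q m = same_cell (H'\<lparr>label := l'\<rparr>) p n q m" .
qed

lemma relabel_functional:
  assumes "functional_heap H" "v \<in> verts H"
  shows "functional_heap (H\<lparr>label := (label H)(x := v)\<rparr>)"
  using assms by (auto simp: functional_heap_def heap_def)

lemma cell_invariant_assign: "cell_invariant (assign_heap x y)"
  unfolding cell_invariant_def
proof (intro conjI allI impI)
  fix H G :: "'a heap" assume H: "functional_heap H" and "assign_heap x y H G"
  then show "functional_heap G"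
    using relabel_functional[OF H functional_heapD(5)[OF H]] by (simp add: assign_heap_def)
next
  fix H H' G :: "'a heap"
  assume H: "functional_heap H" "functional_heap H'" "same_cell H = same_cell H'"
    and G: "assign_heap x y H G"
  have "same_cell (H\<lparr>label := (label H)(x := label H y)\<rparr>) =
      same_cell (H'\<lparr>label := (label H')(x := label H' y)\<rparr>)"
    by (rule relabel_same_cell[OF H, where r = "\<lambda>p. if p = x then y else p" and k = "\<lambda>p. 0"])
       auto
  then show "\<exists>G'. assign_heap x y H' G' \<and> same_cell G = same_cell G'"
    using G by (simp add: assign_heap_def)
qed

lemma cell_at_unit_edge:
  assumes "(label H y, v) \<in> edges H" "weight H (label H y, v) = 1"
  shows "cell_at H y 1 (v, 0)"
  using assms by (auto simp: cell_at_Suc step_Pair)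

text \<open>Together with its converse below, this shows that the relation reveals whether
  \<open>y\<close> can be dereferenced, so that definedness of \<open>lookup_heap\<close> and
  \<open>update_heap\<close> carries over.\<close>

lemma same_cell_1_edge:
  "same_cell H y 1 y 1 \<Longrightarrow> \<exists>v. (label H y, v) \<in> edges H"
  by (auto simp: same_cell_def cell_at_Suc step_def)

lemma edge_same_cell_1:
  assumes "heap H" "(label H y, v) \<in> edges H"
  shows "same_cell H y 1 y 1"
proof -
  have "0 < weight H (label H y, v)" using assms by (auto simp: heap_def)
  then show ?thesis using assms(2) by (auto simp: same_cell_def cell_at_Suc step_Pair)
qed

lemma unit_edge_after_subdivision:
  assumes H: "functional_heap H" and e: "(label H y, v) \<in> edges H"
  shows "\<exists>S v. (S = H \<or> subdivides H S) \<and> (label S y, v) \<in> edges S \<and> weight S (label S y, v) = 1"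
proof (cases "weight H (label H y, v) = 1")
  case False
  then have w: "1 < weight H (label H y, v)" using functional_heapD(4)[OF H e] by linarith
  obtain S q where S: "subdivides H S" "q \<notin> verts H"
    "edges S = (edges H - {(label H y, v)}) \<union> {(label H y, q), (q, v)}"
    "weight S = (weight H)((label H y, q) := 1, (q, v) := weight H (label H y, v) - 1)"
    "label S = label H"
    using subdivides_edge[OF H e w] .
  have "label H y \<noteq> q" using functional_heapD(5)[OF H, of y] S(2) by auto
  then have "(label S y, q) \<in> edges S \<and> weight S (label S y, q) = 1" using S by simp
  then show ?thesis using S(1) by blast
qed (use e in blast)

lemma cell_invariant_lookup: "cell_invariant (lookup_heap x y)"
  unfolding cell_invariant_def
proof (intro conjI allI impI)
  fix H G :: "'a heap" assume H: "functional_heap H" and "lookup_heap x y H G"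
  then obtain S v where S: "S = H \<or> subdivides H S" and v: "(label S y, v) \<in> edges S"
    and G: "G = S\<lparr>label := (label S)(x := v)\<rparr>"
    by (auto simp: lookup_heap_def)
  have fS: "functional_heap S" using S H subdivides_functional by blast
  show "functional_heap G" using relabel_functional[OF fS functional_heapD(8)[OF fS v]] G by simp
next
  fix H H' G :: "'a heap"
  assume H: "functional_heap H" and H': "functional_heap H'"
    and eq: "same_cell H = same_cell H'" and "lookup_heap x y H G"
  then obtain S v where S: "S = H \<or> subdivides H S"
    and v: "(label S y, v) \<in> edges S" "weight S (label S y, v) = 1"
    and G: "G = S\<lparr>label := (label S)(x := v)\<rparr>"
    by (auto simp: lookup_heap_def)
  have fS: "functional_heap S" and cS: "same_cell S = same_cell H"
    using S H subdivides_functional subdivides_same_cell by blast+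
  have "same_cell H' y 1 y 1"
    using edge_same_cell_1[OF functional_heapD(1)[OF fS] v(1)] cS eq by simp
  then obtain S' v' where S': "S' = H' \<or> subdivides H' S'"
    and v': "(label S' y, v') \<in> edges S'" "weight S' (label S' y, v') = 1"
    using same_cell_1_edge unit_edge_after_subdivision[OF H'] by metis
  have fS': "functional_heap S'" and cS': "same_cell S' = same_cell H'"
    using S' H' subdivides_functional subdivides_same_cell by blast+
  have "same_cell (S\<lparr>label := (label S)(x := v)\<rparr>) = same_cell (S'\<lparr>label := (label S')(x := v')\<rparr>)"
    \<comment> \<open>The new label of \<open>x\<close> is the cell one step after \<open>y\<close>;
      every other variable keeps its own cell. Passing to \<open>S\<close> and \<open>S'\<close>
      leaves the relations unchanged.\<close>
    by (rule relabel_same_cell[where r = "\<lambda>p. if p = x then y else p"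
          and k = "\<lambda>p. if p = x then 1 else 0"])
       (use fS fS' cS cS' eq cell_at_unit_edge[OF v] cell_at_unit_edge[OF v'] in auto)
  moreover have "lookup_heap x y H' (S'\<lparr>label := (label S')(x := v')\<rparr>)"
    unfolding lookup_heap_def using S' v' by blast
  ultimately show "\<exists>G'. lookup_heap x y H' G' \<and> same_cell G = same_cell G'" using G by blast
qed

section \<open>New cells and updates\<close>

lemma step_new:
  assumes H: "functional_heap H" and q: "q \<notin> verts H"
    and G: "edges G = insert (q, t) (edges H)" "weight G = (weight H)((q, t) := 1)"
  shows "step G (q, 0) d \<longleftrightarrow> d = (t, 0)"
    and "fst c \<noteq> q \<Longrightarrow> step G c d \<longleftrightarrow> step H c d"
proof -
  have "(q, v) \<notin> edges H" for v using functional_heapD(7)[OF H, of q v] q by blast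
  then show "step G (q, 0) d \<longleftrightarrow> d = (t, 0)" using G by (simp add: step_Pair)
  show "step G c d \<longleftrightarrow> step H c d" if "fst c \<noteq> q" using that G by (auto simp: step_def)
qed

text \<open>The matching of the old cells is extended by sending the fresh cell to the fresh cell.
  Both step to the old null cell, and no old step leads into them. Cells that lose their last name
  may stay in the domain, which need only be closed under \<open>step\<close>.\<close>

lemma cell_invariant_new: "cell_invariant (new_heap x)"
  unfolding cell_invariant_def
proof (intro conjI allI impI)
  fix H G :: "'a heap" assume H: "functional_heap H" and "new_heap x H G"
  then obtain q where q: "q \<notin> verts H"
    and G: "G = H\<lparr>verts := insert q (verts H),
            edges := insert (q, label H null_ptr) (edges H),
            weight := (weight H)((q, label H null_ptr) := 1),
            label := (label H)(x := q)\<rparr>"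
    by (auto simp: new_heap_def)
  have "(q, v) \<notin> edges H" for v using functional_heapD(7)[OF H, of q v] q by blast
  then have "single_valued (edges G)"
    using functional_heapD(6)[OF H] G by (auto simp: single_valued_def)
  moreover have "heap G" using functional_heapD(2-5)[OF H] G by (auto simp: heap_def)
  ultimately show "functional_heap G" by (simp add: functional_heap_def)
next
  fix H H' G :: "'a heap"
  assume H: "functional_heap H" and H': "functional_heap H'"
    and eq: "same_cell H = same_cell H'" and "new_heap x H G"
  then obtain q where q: "q \<notin> verts H"
    and G: "G = H\<lparr>verts := insert q (verts H),
            edges := insert (q, label H null_ptr) (edges H),
            weight := (weight H)((q, label H null_ptr) := 1),
            label := (label H)(x := q)\<rparr>"
    by (auto simp: new_heap_def)
  obtain q' where q': "q' \<notin> verts H'" using functional_heapD(2)[OF H'] ex_new_if_finite by blast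
  define G' where "G' = H'\<lparr>verts := insert q' (verts H'),
            edges := insert (q', label H' null_ptr) (edges H'),
            weight := (weight H')((q', label H' null_ptr) := 1),
            label := (label H')(x := q')\<rparr>"
  have stG: "step G (q, 0) d \<longleftrightarrow> d = (label H null_ptr, 0)"
      "fst c \<noteq> q \<Longrightarrow> step G c d \<longleftrightarrow> step H c d" for c d
    using step_new[OF H q, of G "label H null_ptr"] G by simp_all
  have stG': "step G' (q', 0) d \<longleftrightarrow> d = (label H' null_ptr, 0)"
      "fst c \<noteq> q' \<Longrightarrow> step G' c d \<longleftrightarrow> step H' c d" for c d
    using step_new[OF H' q', of G' "label H' null_ptr"] G'_def by simp_all
  obtain g where lab: "\<And>p. g (label H p, 0) = (label H' p, 0)"
    and inj: "inj_on g (reachable_cells H)"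
    and img: "g ` reachable_cells H \<subseteq> reachable_cells H'"
    and fwd: "\<And>c d. c \<in> reachable_cells H \<Longrightarrow> step H c d \<Longrightarrow> step H' (g c) (g d)"
    and bwd: "\<And>c d'. c \<in> reachable_cells H \<Longrightarrow> step H' (g c) d' \<Longrightarrow> \<exists>d. step H c d \<and> d' = g d"
    using same_cell_simulation[OF H H' eq] by metis
  have nq: "fst c \<noteq> q" "fst (g c) \<noteq> q'" "c \<noteq> (q, 0)" if "c \<in> reachable_cells H" for c
    using reachable_cells_in_verts[OF functional_heapD(1)[OF H] that] q q'
      reachable_cells_in_verts[OF functional_heapD(1)[OF H'], of "g c"] img that by auto
  \<comment> \<open>No reachable cell of \<open>H\<close> lies on \<open>q\<close>, so the override
    leaves \<open>g\<close> intact on the old domain.\<close>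
  define g' where "g' = g((q, 0) := (q', 0))"
  have g'q: "g' (q, 0) = (q', 0)" by (simp add: g'_def)
  have g'c: "g' c = g c" if "c \<in> reachable_cells H" for c using nq(3)[OF that] by (simp add: g'_def)
  have labG: "label G p = (if p = x then q else label H p)"
      "label G' p = (if p = x then q' else label H' p)" for p by (simp_all add: G G'_def)
  have "same_cell G = same_cell G'"
  proof (rule same_cell_transfer[where g = g' and C = "insert (q, 0) (reachable_cells H)"])
    show "g' (label G p, 0) = (label G' p, 0)" for p
      using g'q g'c[OF reachable_cells_label] lab by (simp add: labG)
    show "(label G p, 0) \<in> insert (q, 0) (reachable_cells H)" for p
      using reachable_cells_label[of H p] by (simp add: labG)
    have "g' (q, 0) \<noteq> g' c" if "c \<in> reachable_cells H" for c
      using nq(2)[OF that] g'q g'c[OF that] by (metis fst_conv)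
    moreover have "inj_on g' (reachable_cells H)"
      using inj g'c by (simp cong: inj_on_cong)
    ultimately show "inj_on g' (insert (q, 0) (reachable_cells H))"
      unfolding inj_on_insert by blast
  next
    fix c d assume c: "c \<in> insert (q, 0) (reachable_cells H)" and s: "step G c d"
    show "d \<in> insert (q, 0) (reachable_cells H) \<and> step G' (g' c) (g' d)"
    proof (cases "c = (q, 0)")
      case True
      then have "d = (label H null_ptr, 0)" using s stG by simp
      then show ?thesis
        using True g'q g'c[OF reachable_cells_label] reachable_cells_label[of H null_ptr] lab stG'
        by simp
    next
      case False
      then have c: "c \<in> reachable_cells H" using c by simp
      then have sH: "step H c d" using s nq stG by blast
      then have "d \<in> reachable_cells H" using c reachable_cells_step by blast
      then show ?thesis using fwd[OF c sH] stG'(2)[OF nq(2)[OF c]] g'c c by simp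
    qed
  next
    fix c d' assume c: "c \<in> insert (q, 0) (reachable_cells H)" and s: "step G' (g' c) d'"
    show "\<exists>d. step G c d \<and> d' = g' d"
    proof (cases "c = (q, 0)")
      case True
      then have "d' = (label H' null_ptr, 0)" using s stG' g'q by simp
      then show ?thesis using True g'c[OF reachable_cells_label] lab stG(1) by metis
    next
      case False
      then have c: "c \<in> reachable_cells H" using c by simp
      then have "step H' (g c) d'" using s stG'(2)[OF nq(2)[OF c]] g'c by simp
      then obtain d where d: "step H c d" "d' = g d" using bwd[OF c] by blast
      then have "d \<in> reachable_cells H" using c reachable_cells_step by blast
      then show ?thesis using d g'c stG(2)[OF nq(1)[OF c]] by metis
    qed
  qed
  moreover have "new_heap x H' G'" unfolding new_heap_def G'_def using q' by blast
  ultimately show "\<exists>G'. new_heap x H' G' \<and> same_cell G = same_cell G'" by blast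
qed

lemma step_update:
  assumes H: "functional_heap H" and e: "(a, v) \<in> edges H"
    and G: "edges G = insert (a, b) (edges H - {(a, v)})" "weight G = (weight H)((a, b) := 1)"
  shows "step G (a, 0) d \<longleftrightarrow> d = (b, 0)"
    and "fst c \<noteq> a \<Longrightarrow> step G c d \<longleftrightarrow> step H c d"
proof -
  have "(a, t) \<in> edges G \<longleftrightarrow> t = b" for t
    using functional_heapD(6)[OF H e] G(1) by blast
  then show "step G (a, 0) d \<longleftrightarrow> d = (b, 0)" using G(2) by (simp add: step_Pair)
  show "step G c d \<longleftrightarrow> step H c d" if "fst c \<noteq> a" using that G by (auto simp: step_def)
qed

text \<open>The matching of the old cells is kept on a smaller domain, where only the source cell of
  the update has a changed successor. Both coordinates must be restricted, since a cell inside the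
  replaced edge of one heap may lie on a separate vertex of the other.\<close>

lemma cell_invariant_update: "cell_invariant (update_heap x y)"
  unfolding cell_invariant_def
proof (intro conjI allI impI)
  fix H G :: "'a heap" assume H: "functional_heap H" and "update_heap x y H G"
  then obtain v where v: "(label H x, v) \<in> edges H"
    and G: "G = H\<lparr>edges := insert (label H x, label H y) (edges H - {(label H x, v)}),
            weight := (weight H)((label H x, label H y) := 1)\<rparr>"
    by (auto simp: update_heap_def)
  have "single_valued (edges G)"
    using functional_heapD(6)[OF H] functional_heapD(6)[OF H v] G
    by (auto simp: single_valued_def)
  moreover have "heap G" using functional_heapD(2-5)[OF H] G by (auto simp: heap_def)
  ultimately show "functional_heap G" by (simp add: functional_heap_def)
next
  fix H H' G :: "'a heap"
  assume H: "functional_heap H" and H': "functional_heap H'"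
    and eq: "same_cell H = same_cell H'" and "update_heap x y H G"
  then obtain v where v: "(label H x, v) \<in> edges H"
    and G: "G = H\<lparr>edges := insert (label H x, label H y) (edges H - {(label H x, v)}),
            weight := (weight H)((label H x, label H y) := 1)\<rparr>"
    by (auto simp: update_heap_def)
  have "same_cell H' x 1 x 1"
    using edge_same_cell_1[OF functional_heapD(1)[OF H] v(1)] eq by simp
  then obtain v' where v': "(label H' x, v') \<in> edges H'" using same_cell_1_edge by metis
  define G' where
    "G' = H'\<lparr>edges := insert (label H' x, label H' y) (edges H' - {(label H' x, v')}),
            weight := (weight H')((label H' x, label H' y) := 1)\<rparr>"
  have stG: "step G (label H x, 0) d \<longleftrightarrow> d = (label H y, 0)"
      "fst c \<noteq> label H x \<Longrightarrow> step G c d \<longleftrightarrow> step H c d" for c d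
    using step_update[OF H v, of G "label H y"] G by simp_all
  have stG': "step G' (label H' x, 0) d \<longleftrightarrow> d = (label H' y, 0)"
      "fst c \<noteq> label H' x \<Longrightarrow> step G' c d \<longleftrightarrow> step H' c d" for c d
    using step_update[OF H' v', of G' "label H' y"] G'_def by simp_all
  obtain g where lab: "\<And>p. g (label H p, 0) = (label H' p, 0)"
    and inj: "inj_on g (reachable_cells H)"
    and fwd: "\<And>c d. c \<in> reachable_cells H \<Longrightarrow> step H c d \<Longrightarrow> step H' (g c) (g d)"
    and bwd: "\<And>c d'. c \<in> reachable_cells H \<Longrightarrow> step H' (g c) d' \<Longrightarrow> \<exists>d. step H c d \<and> d' = g d"
    using same_cell_simulation[OF H H' eq] by metis
  \<comment> \<open>The cells inside the replaced edge are unreachable after the update, in both heaps.\<close>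
  define C where "C = {c \<in> reachable_cells H. (fst c = label H x \<longrightarrow> snd c = 0) \<and>
    (fst (g c) = label H' x \<longrightarrow> snd (g c) = 0)}"
  have CH: "c \<in> reachable_cells H" if "c \<in> C" for c using that by (simp add: C_def)
  have lC: "(label H p, 0) \<in> C" for p using reachable_cells_label lab by (auto simp: C_def)
  have off: "fst c \<noteq> label H x" "fst (g c) \<noteq> label H' x" if c: "c \<in> C" "c \<noteq> (label H x, 0)" for c
  proof -
    show "fst c \<noteq> label H x" using c by (auto simp: C_def prod_eq_iff)
    \<comment> \<open>On \<open>C\<close> the only image on the vertex \<open>label H' x\<close>
      would have offset 0, and by injectivity that one belongs to the source cell.\<close>
    have "g c \<noteq> g (label H x, 0)" using c CH inj lC by (meson inj_onD)
    then show "fst (g c) \<noteq> label H' x" using c by (auto simp: C_def prod_eq_iff lab)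
  qed
  \<comment> \<open>A step onto another vertex arrives at offset 0, so the interior of the replaced
    edge is never entered from elsewhere. This makes \<open>C\<close> closed.\<close>
  have snd0: "snd d = 0" if "step K c d" "fst c \<noteq> a" "fst d = a" for K :: "'a heap" and a c d
    using that by (auto simp: step_def split: if_splits)
  have "same_cell G = same_cell G'"
  proof (rule same_cell_transfer[where g = g and C = C])
    show "g (label G p, 0) = (label G' p, 0)" for p using lab by (simp add: G G'_def)
    show "(label G p, 0) \<in> C" for p using lC by (simp add: G)
    show "inj_on g C" using inj CH by (meson inj_on_subset subsetI)
  next
    fix c d assume c: "c \<in> C" and s: "step G c d"
    show "d \<in> C \<and> step G' (g c) (g d)"
    proof (cases "c = (label H x, 0)")
      case True
      then show ?thesis using s stG stG' lC lab by simp
    next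
      case False
      have sH: "step H c d" using s stG off[OF c False] by blast
      have sH': "step H' (g c) (g d)" using fwd CH c sH by blast
      have "d \<in> C" unfolding C_def
        using reachable_cells_step[OF CH[OF c] sH] snd0[OF sH] snd0[OF sH'] off[OF c False] by auto
      then show ?thesis using sH' stG' off[OF c False] by blast
    qed
  next
    fix c d' assume c: "c \<in> C" and s: "step G' (g c) d'"
    show "\<exists>d. step G c d \<and> d' = g d"
    proof (cases "c = (label H x, 0)")
      case True
      then show ?thesis using s stG stG' lab by simp
    next
      case False
      then show ?thesis using s stG stG' off[OF c False] bwd[OF CH[OF c]] by metis
    qed
  qed
  moreover have "update_heap x y H' G'" unfolding update_heap_def G'_def using v' by blast
  ultimately show "\<exists>G'. update_heap x y H' G' \<and> same_cell G = same_cell G'" by blast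
qed

section \<open>Invariance of truth\<close>

lemma sat_cong:
  fixes T :: "('f, 'r, 'd) background" and \<Gamma> \<Gamma>' :: "('h, 'p::pointer, 'a, 'd) interp"
  assumes H: "\<And>h. functional_heap (heap_of \<Gamma> h)" "\<And>h. functional_heap (heap_of \<Gamma>' h)"
      "\<And>h. same_cell (heap_of \<Gamma> h) = same_cell (heap_of \<Gamma>' h)"
    and v: "val_of \<Gamma> = val_of \<Gamma>'"
  shows "sat T \<Gamma> \<phi> \<longleftrightarrow> sat T \<Gamma>' \<phi>"
proof -
  have hp: "heap (heap_of \<Gamma> h)" "heap (heap_of \<Gamma>' h)" for h
    using H(1,2) functional_heapD(1) by blast+
  have t: "term_val T \<Gamma> t = term_val T \<Gamma>' t" for t
    by (induction t) (auto simp: v path_length_same_cell[OF hp(1)] path_length_same_cell[OF hp(2)]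
        H(3) cong: map_cong)
  then have ts: "term_val T \<Gamma> = term_val T \<Gamma>'" by (intro ext)
  note tr = cell_invariant_homeomorphic[OF _ H(1) H(2) H(3) H(1) H(2) H(3)]
  show ?thesis
    by (induction \<phi>)
       (simp_all add: ts is_alias_same_cell is_null_same_cell H(3)
         is_path_same_cell[OF hp(1)] is_path_same_cell[OF hp(2)]
         circular_same_cell[OF hp(1)] circular_same_cell[OF hp(2)]
         tr[OF cell_invariant_new] tr[OF cell_invariant_assign]
         tr[OF cell_invariant_lookup] tr[OF cell_invariant_update])
qed

section \<open>Existence of kernels\<close>

text \<open>Restricting the sources of edges is enough, because edges from reachable vertices end in
  reachable vertices.\<close>

definition reachable_part :: "'p heap \<Rightarrow> 'p heap" where
  "reachable_part H = H\<lparr>verts := reachable H, edges := edges H \<inter> reachable H \<times> UNIV\<rparr>"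

lemma reachable_label: "label H p \<in> reachable H"
  by (auto simp: reachable_def)

lemma reachable_edge: "u \<in> reachable H \<Longrightarrow> (u, v) \<in> edges H \<Longrightarrow> v \<in> reachable H"
  unfolding reachable_def by (blast intro: rtrancl_into_rtrancl)

lemma reachable_subset_verts:
  assumes "heap H"
  shows "reachable H \<subseteq> verts H"
proof -
  have "v \<in> verts H" if "(label H p, v) \<in> (edges H)\<^sup>*" for p v
    using that by (cases rule: rtranclE) (use assms in \<open>auto simp: heap_def\<close>)
  then show ?thesis by (auto simp: reachable_def)
qed

lemma reachable_part_same_cell: "same_cell (reachable_part H) = same_cell H"
  by (rule same_cell_transfer[where g = "\<lambda>c. c" and C = "reachable H \<times> UNIV"])
     (auto simp: reachable_part_def step_Pair reachable_label split: if_splits intro: reachable_edge)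

lemma reachable_part_singly_linked:
  assumes "singly_linked H"
  shows "singly_linked (reachable_part H)"
proof -
  have h: "heap H" using assms by (simp add: singly_linked_def)
  note sub = reachable_subset_verts[OF h]
  have "heap (reachable_part H)"
    using h sub reachable_label reachable_edge
    by (auto simp: heap_def reachable_part_def intro: finite_subset)
  moreover have "{t. (v, t) \<in> edges (reachable_part H)} = {t. (v, t) \<in> edges H}"
    if "v \<in> reachable H" for v using that by (auto simp: reachable_part_def)
  ultimately show ?thesis
    using assms sub by (auto simp: singly_linked_def reachable_part_def)
qed

text \<open>\<open>smooths\<close> promises only a heap. Outdegrees are inherited because away from
  \<open>u\<close> the edges agree, and at \<open>u\<close> the edge to \<open>q\<close> becomes the
  edge to \<open>v\<close>.\<close>

lemma smooths_singly_linked: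
  assumes K: "singly_linked K" and s: "smooths K K'"
  shows "singly_linked K'" "card (verts K') < card (verts K)"
proof -
  have h: "heap K'" and s: "subdivides K' K" using s by (auto simp: smooths_def)
  obtain u v q where uv: "(u, v) \<in> edges K'" and q: "q \<notin> verts K'"
    and V: "verts K = insert q (verts K')"
    and E: "edges K = (edges K' - {(u, v)}) \<union> {(u, q), (q, v)}"
    and "\<forall>e \<in> edges K' - {(u, v)}. weight K e = weight K' e"
    and "0 < weight K (u, q)" "0 < weight K (q, v)"
    and "weight K (u, q) + weight K (q, v) = weight K' (u, v)"
    and L: "label K = label K'"
    using s by (rule subdividesE)
  have fin: "finite (verts K')" using h by (simp add: heap_def)
  then show "card (verts K') < card (verts K)" using q V by simp
  have cK: "card {t. (w, t) \<in> edges K} = (if w = label K' null_ptr then 0 else 1)"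
    if "w \<in> verts K'" for w
    using K that V L by (auto simp: singly_linked_def)
  have inK: "w \<in> verts K'" "t \<in> verts K'" if "(w, t) \<in> edges K'" for w t
    using that h by (auto simp: heap_def)
  have "card {t. (w, t) \<in> edges K'} = (if w = label K' null_ptr then 0 else 1)"
    if w: "w \<in> verts K'" for w
  proof (cases "w = u")
    case True
    have Kq: "t = q" if "(u, t) \<in> edges K" for t
      using functional_heapD(6)[OF singly_linked_functional[OF K] that] E by blast
    then have Ku: "{t. (u, t) \<in> edges K} = {q}" using E by blast
    \<comment> \<open>A second edge from \<open>u\<close> in \<open>K'\<close> would survive the
      subdivision and compete in \<open>K\<close> with the edge to \<open>q\<close>.\<close>
    have "t = v" if t: "(u, t) \<in> edges K'" for t
    proof (rule ccontr)
      assume "t \<noteq> v"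
      then have "(u, t) \<in> edges K" using E t by simp
      then show False using Kq inK(2)[OF t] q by simp
    qed
    then have "{t. (u, t) \<in> edges K'} = {v}" using uv by blast
    moreover have "u \<noteq> label K' null_ptr" using cK[of u] Ku inK[OF uv] by auto
    ultimately show ?thesis using True by simp
  next
    case False
    then have "{t. (w, t) \<in> edges K'} = {t. (w, t) \<in> edges K}" using E w q by auto
    then show ?thesis using cK[OF w] by simp
  qed
  then show "singly_linked K'" using h by (simp add: singly_linked_def)
qed

text \<open>A vertex-minimal heap with the given relation works: dropping unreachable vertices keeps
  the relation, so there are none, and a smoothing would keep it with fewer vertices.
  \<open>H\<close> itself shows that a minimum exists.\<close>

lemma kernel_exists:
  assumes "singly_linked H"
  obtains K where "is_kernel_of K H"
proof -
  let ?P = "\<lambda>K. singly_linked K \<and> same_cell K = same_cell H"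
  obtain K where K: "singly_linked K" "same_cell K = same_cell H"
    and least: "\<And>K'. ?P K' \<Longrightarrow> card (verts K) \<le> card (verts K')"
    using ex_has_least_nat[of ?P H "\<lambda>K. card (verts K)"] assms by blast
  have h: "heap K" using K by (simp add: singly_linked_def)
  have "card (verts K) \<le> card (verts (reachable_part K))"
    using K by (intro least) (simp add: reachable_part_singly_linked reachable_part_same_cell)
  then have "card (verts K) \<le> card (reachable K)" by (simp add: reachable_part_def)
  then have "verts K = reachable K"
    using reachable_subset_verts[OF h] h card_seteq[of "verts K" "reachable K"]
    by (auto simp: heap_def)
  moreover have "\<not> smooths K K'" for K'
  proof
    assume s: "smooths K K'"
    have K': "singly_linked K'" "card (verts K') < card (verts K)"
      using smooths_singly_linked[OF K(1) s] .
    have "same_cell K = same_cell K'"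
      using subdivides_same_cell singly_linked_functional[OF K'(1)] s
      by (auto simp: smooths_def)
    then show False using least[of K'] K K' by simp
  qed
  moreover have "K \<sim> H"
    using homeomorphic_iff_same_cell singly_linked_functional K assms by blast
  ultimately show ?thesis using that K by (auto simp: is_kernel_of_def)
qed

theorem theorem3:
  fixes T :: "('f, 'r, 'd) background"
    and \<Gamma> :: "('h, 'p::pointer, 'a, 'd) interp"
    and \<phi> :: "('h, 'p, 'a, 'f, 'r) slh_form"
  assumes "interpretation_slh \<Gamma>"
    and "sat T \<Gamma> (Neg \<phi>)"
  shows "\<exists>\<Gamma>' :: ('h, 'p, 'a, 'd) interp.
           interpretation_slh \<Gamma>' \<and> sat T \<Gamma>' (Neg \<phi>) \<and>
           (\<forall>h. homeomorphism_kernel (heap_of \<Gamma>' h))"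
proof -
  have sl: "singly_linked (heap_of \<Gamma> h)" for h
    using assms(1) by (simp add: interpretation_slh_def)
  have "\<forall>h. \<exists>K. is_kernel_of K (heap_of \<Gamma> h)" using kernel_exists[OF sl] by blast
  \<comment> \<open>The kernels are chosen independently for each heap variable. Transformer atoms
    tolerate this because they are read up to \<open>\<sim>\<close>.\<close>
  then obtain k where k: "\<And>h. is_kernel_of (k h) (heap_of \<Gamma> h)" by metis
  have slk: "singly_linked (k h)" for h using k by (simp add: is_kernel_of_def)
  define \<Gamma>' where "\<Gamma>' = \<Gamma>\<lparr>heap_of := k\<rparr>"
  note fH = singly_linked_functional[OF sl] and fk = singly_linked_functional[OF slk]
  have eq: "same_cell (k h) = same_cell (heap_of \<Gamma> h)" for h
    using k[of h] homeomorphic_iff_same_cell[OF fk fH] by (simp add: is_kernel_of_def)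
  have "sat T \<Gamma>' \<phi> \<longleftrightarrow> sat T \<Gamma> \<phi>"
    by (rule sat_cong) (simp_all add: \<Gamma>'_def fH fk eq)
  then have "sat T \<Gamma>' (Neg \<phi>)" using assms(2) by simp
  moreover have "interpretation_slh \<Gamma>'" using slk by (simp add: interpretation_slh_def \<Gamma>'_def)
  moreover have "homeomorphism_kernel (heap_of \<Gamma>' h)" for h
    using k sl by (auto simp: homeomorphism_kernel_def \<Gamma>'_def)
  ultimately show ?thesis by blast
qed

end
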